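(* For each integer $d\ge 2$: (1) The first imbalance whose reduced denominator equals $d$ is the unit fraction $\delta(p,q)=1/d$. (2) The iteration index of this occurrence is $$I(d)=\begin{cases}\dfrac{d^2-9}{8}, & d\text{ odd},\\[8pt] \dfrac{d(d+1)}{2}-2, & d\text{ even}.\end{cases}$$ (3) As $d$ increases through $\mathbb{Z}_{>0}$, the denominators appear in the order $$3,2,5,7,4,9,11,6,13,15,8,17,19,10,21,23,12,\dots,$$ and every positive integer occurs exactly once.
   Context: Consider all pairs of integers $(p,q)$ with $p\ge 2$ and $1\le q<p$. The imbalance of such a pair is $\delta(p,q)=\frac{p-q}{p+q}$. The pairs are processed in lexicographic order: $(p_1,q_1)$ precedes $(p_2,q_2)$ if either $p_1<p_2$, or $p_1=p_2$ and $q_1<q_2$. Each pair is assigned the iteration index $i(p,q)=\frac{(p-2)(p-1)}{2}+(q-1)$, so that $i(2,1)=0$, $i(3,1)=1$, $i(3,2)=2$, etc. Each imbalance is expressed in lowest terms as $\delta(p,q)=\frac{a(p,q)}{d(p,q)}$ with $\gcd(a(p,q),d(p,q))=1$, and $d(p,q)$ is called the reduced denominator. The sieve enumerates these reduced fractions in increasing order of $i(p,q)$ and records new denominators as they first appear. The first appearance index of a denominator $d$ is $I(d)=\min\{\,i(p,q): d(p,q)=d\,\}$.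
   Formalization: "Every positive integer occurs exactly once" is proved for every integer d ≥ 2; the integer 1 never occurs, because every imbalance lies strictly between 0 and 1, so its reduced denominator is never 1. *)

theory Defs
  imports Complex_Main "HOL-Library.Infinite_Set"
begin

definition pairs :: "(nat \<times> nat) set" where
  "pairs = {(p, q). 2 \<le> p \<and> 1 \<le> q \<and> q < p}"

definition imbalance :: "nat \<times> nat \<Rightarrow> rat" where
  "imbalance = (\<lambda>(p, q). (of_nat p - of_nat q) / (of_nat p + of_nat q))"

definition reduced_denom :: "nat \<times> nat \<Rightarrow> nat" where
  "reduced_denom x = nat (snd (quotient_of (imbalance x)))"

definition precedes :: "nat \<times> nat \<Rightarrow> nat \<times> nat \<Rightarrow> bool" where
  "precedes x y \<longleftrightarrow> (x, y) \<in> less_than <*lex*> less_than"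

(* On pairs no subtraction truncates, and the division by 2 is exact. *)
definition iteration_index :: "nat \<times> nat \<Rightarrow> nat" where
  "iteration_index = (\<lambda>(p, q). (p - 2) * (p - 1) div 2 + (q - 1))"

definition first_occurrence :: "nat \<Rightarrow> nat \<times> nat \<Rightarrow> bool" where
  "first_occurrence d x \<longleftrightarrow>
     x \<in> pairs \<and> reduced_denom x = d \<and>
     (\<forall>y\<in>pairs. reduced_denom y = d \<and> y \<noteq> x \<longrightarrow> precedes x y)"

(* The minimum I(d); unspecified if d is not the reduced denominator of any pair. *)
definition first_index :: "nat \<Rightarrow> nat" where
  "first_index d = (LEAST n. \<exists>x\<in>pairs. reduced_denom x = d \<and> iteration_index x = n)"

(* The index is a bijection from pairs onto the natural numbers, so every step
   handles exactly one pair. *)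
definition pair_at :: "nat \<Rightarrow> nat \<times> nat" where
  "pair_at = inv_into pairs iteration_index"

definition recording_steps :: "nat set" where
  "recording_steps =
     {n. \<forall>m<n. reduced_denom (pair_at m) \<noteq> reduced_denom (pair_at n)}"

(* The k-th denominator recorded by the sieve, counting from 0. The set of
   recording steps is infinite, so enumerate lists it increasingly. *)
definition recorded :: "nat \<Rightarrow> nat" where
  "recorded k = reduced_denom (pair_at (enumerate recording_steps k))"

end

theory Submission imports Defs begin

text \<open>
  The reduced denominator of \<open>(p, q)\<close> is \<open>(p + q) div gcd (p - q) (p + q)\<close>, so a pair
  with reduced denominator \<open>d\<close> satisfies \<open>d dvd p + q\<close>, and in particular \<open>d \<le> p + q\<close>.  Since
  \<open>q < p\<close>, this forces \<open>p > d / 2\<close>, and for odd \<open>d\<close> the lexicographically least pair allowed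
  by these constraints is \<open>((d + 1) / 2, (d - 1) / 2)\<close>, whose imbalance is indeed \<open>1 / d\<close>.
  For even \<open>d\<close> the case \<open>p + q = d\<close> is impossible: \<open>p - q\<close> would be even too, and the fraction
  would reduce further.  Hence \<open>p + q \<ge> 2 d\<close>, so \<open>p \<ge> d + 1\<close>, and the least
  possibility is now \<open>(d + 1, d - 1)\<close> with imbalance \<open>2 / (2 d)\<close>
  (lemma \<open>first_occurrence_first_pair\<close>).

  The iteration index is an isomorphism from the lexicographically ordered pairs onto the natural
  numbers (lemmas \<open>iteration_index_strict_mono\<close> and \<open>iteration_index_surj\<close>).
  Hence first occurrence and least index agree, and the recording steps are exactly the
  numbers \<open>first_index d\<close> with \<open>d \<ge> 2\<close>.

  The order of appearance has a closed form.  In blocks of three, the denominators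
  \<open>4 j + 3\<close>, \<open>2 j + 2\<close>, \<open>4 j + 5\<close> have first indices \<open>2 j\<^sup>2 + 3 j\<close>, \<open>2 j\<^sup>2 + 5 j + 1\<close>,
  \<open>2 j\<^sup>2 + 5 j + 2\<close>, and the next block starts at \<open>2 j\<^sup>2 + 7 j + 5\<close>; so these indices increase
  strictly.  The blocks exhaust all \<open>d \<ge> 2\<close>, so they list the recording steps in increasing
  order, which is what \<open>recorded\<close> does.  Evaluating the closed form gives the list of the first
  denominators.
\<close>

section \<open>The iteration index enumerates the pairs in lexicographic order\<close>

lemma two_times_iteration_index:
  assumes "p \<ge> 2" "q \<ge> 1"
  shows "2 * iteration_index (p, q) = (p - 2) * (p - 1) + 2 * (q - 1)"
proof -
  have "even ((p - 2) * (p - 1))"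
    using assms by (cases "even p") auto
  then show ?thesis
    by (simp add: iteration_index_def)
qed

text \<open>The row of \<open>p\<close> occupies the \<open>p - 1\<close> consecutive indices that start at the triangular
  number \<open>(p - 2) (p - 1) / 2\<close>, hence ends before the row of \<open>p + 1\<close> begins.\<close>

lemma iteration_index_strict_mono:
  assumes "x \<in> pairs" "y \<in> pairs" "precedes x y"
  shows "iteration_index x < iteration_index y"
proof -
  obtain p q p' q' where xy: "x = (p, q)" "y = (p', q')"
    by (cases x, cases y)
  have bounds: "2 \<le> p" "1 \<le> q" "q < p" "2 \<le> p'" "1 \<le> q'" "q' < p'"
    using assms by (auto simp: pairs_def xy)
  have "2 * iteration_index x < 2 * iteration_index y"
  proof (cases "p < p'")
    case True
    have "(p - 2) * (p - 1) + 2 * (q - 1) < (p - 2) * (p - 1) + 2 * (p - 1)"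
      using bounds by simp
    also have "\<dots> = p * (p - 1)"
      using bounds by (metis add_mult_distrib le_add_diff_inverse2)
    also have "\<dots> \<le> (p' - 1) * (p' - 2)"
      using True by (intro mult_mono) auto
    finally show ?thesis
      using bounds by (simp add: two_times_iteration_index xy mult.commute)
  next
    case False
    then have "p = p'" "q < q'"
      using assms(3) by (auto simp: precedes_def xy)
    then show ?thesis
      using bounds by (simp add: two_times_iteration_index xy)
  qed
  then show ?thesis by simp
qed

lemma precedes_linear: "x \<noteq> y \<Longrightarrow> precedes x y \<or> precedes y x"
  by (cases x; cases y) (auto simp: precedes_def)

lemma inj_on_iteration_index: "inj_on iteration_index pairs"
  by (metis inj_onI iteration_index_strict_mono less_irrefl precedes_linear)

text \<open>Walking through the pairs, the next pair is \<open>(p, q + 1)\<close> inside a row and \<open>(p + 1, 1)\<close> at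
  its end; in both cases the index grows by one.\<close>

lemma iteration_index_surj: "\<exists>x\<in>pairs. iteration_index x = n"
proof (induction n)
  case 0
  show ?case
    by (intro bexI[of _ "(2, 1)"]) (auto simp: iteration_index_def pairs_def)
next
  case (Suc n)
  then obtain p q where pq: "2 \<le> p" "1 \<le> q" "q < p" "iteration_index (p, q) = n"
    by (auto simp: pairs_def)
  show ?case
  proof (cases "Suc q < p")
    case True
    have "iteration_index (p, Suc q) = Suc n"
      using pq by (simp add: iteration_index_def)
    then show ?thesis
      using True pq by (intro bexI[of _ "(p, Suc q)"]) (auto simp: pairs_def)
  next
    case False
    then have p: "p = Suc q"
      using pq by simp
    obtain r where r: "q = Suc r"
      using pq(2) by (cases q) auto
    have "2 * iteration_index (Suc p, 1) = 2 * iteration_index (p, q) + 2"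
      using two_times_iteration_index[of "Suc p" 1] two_times_iteration_index[of p q] pq
      by (simp add: p r)
    then have "iteration_index (Suc p, 1) = Suc n"
      using pq by simp
    then show ?thesis
      using pq by (intro bexI[of _ "(Suc p, 1)"]) (auto simp: pairs_def)
  qed
qed

lemma pair_at_in_pairs: "pair_at n \<in> pairs"
  unfolding pair_at_def using iteration_index_surj[of n] by (intro inv_into_into) blast

lemma iteration_index_pair_at: "iteration_index (pair_at n) = n"
  unfolding pair_at_def using iteration_index_surj[of n] by (intro f_inv_into_f) blast

lemma pair_at_iteration_index: "x \<in> pairs \<Longrightarrow> pair_at (iteration_index x) = x"
  unfolding pair_at_def by (rule inv_into_f_f[OF inj_on_iteration_index])

section \<open>The first occurrence of a denominator\<close>

lemma reduced_denom_eq: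
  assumes "0 < p" "q \<le> p"
  shows "reduced_denom (p, q) = (p + q) div gcd (p - q) (p + q)"
proof -
  have "imbalance (p, q) = Fract (int (p - q)) (int (p + q))"
    using assms by (simp add: imbalance_def Fract_of_int_quotient)
  then have "snd (quotient_of (imbalance (p, q))) =
      int (p + q) div gcd (int (p - q)) (int (p + q))"
    using assms by (simp add: quotient_of_Fract normalize_def Let_def)
  also have "\<dots> = int ((p + q) div gcd (p - q) (p + q))"
    by (simp only: gcd_int_int_eq zdiv_int)
  finally show ?thesis
    by (simp add: reduced_denom_def)
qed

text \<open>An imbalance lies strictly between 0 and 1, so it is not an integer.\<close>

lemma reduced_denom_ge_2:
  assumes "x \<in> pairs"
  shows "reduced_denom x \<ge> 2"
proof -
  obtain p q where x: "x = (p, q)" "2 \<le> p" "1 \<le> q" "q < p"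
    using assms by (auto simp: pairs_def)
  let ?g = "gcd (p - q) (p + q)"
  obtain k where k: "p + q = ?g * k"
    by (meson dvdE gcd_dvd2)
  have g: "0 < ?g" "?g \<le> p - q"
    using x by (auto intro!: dvd_imp_le)
  have "?g * 1 < ?g * k"
    using g x k by linarith
  then have "1 < k"
    by simp
  moreover have "(p + q) div ?g = k"
    using g by (subst k) simp
  then have "reduced_denom x = k"
    using x by (simp add: reduced_denom_eq)
  ultimately show ?thesis by simp
qed

text \<open>An even denominator cannot come from \<open>p + q\<close> itself, because \<open>p - q\<close> has the same
  parity as \<open>p + q\<close> and a common factor 2 cancels.\<close>

lemma reduced_denom_dvd_sum:
  assumes "(p, q) \<in> pairs" "reduced_denom (p, q) = d"
  obtains k where "p + q = k * d" "k \<ge> 1" "even d \<Longrightarrow> k \<ge> 2"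
proof -
  have pq: "2 \<le> p" "1 \<le> q" "q < p"
    using assms(1) by (auto simp: pairs_def)
  let ?g = "gcd (p - q) (p + q)"
  have sum: "p + q = ?g * d"
    using pq assms(2) reduced_denom_eq[of p q] by (metis dvd_mult_div_cancel gcd_dvd2
        less_imp_le_nat less_le_trans zero_less_numeral)
  have "?g > 0"
    using pq by simp
  moreover have "?g \<ge> 2" if "even d"
  proof -
    have "even (p + q)"
      using that sum by (metis dvd_mult)
    then have "2 dvd ?g"
      using pq by simp
    then show ?thesis
      using \<open>?g > 0\<close> by (auto intro: dvd_imp_le)
  qed
  ultimately show ?thesis
    using sum that[of ?g] by linarith
qed

definition first_pair :: "nat \<Rightarrow> nat \<times> nat" where
  "first_pair d = (if odd d then ((d + 1) div 2, (d - 1) div 2) else (d + 1, d - 1))"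

lemma first_pair_in_pairs: "d \<ge> 2 \<Longrightarrow> first_pair d \<in> pairs"
  by (auto simp: first_pair_def pairs_def elim!: oddE)

lemma imbalance_first_pair:
  assumes "d \<ge> 2"
  shows "imbalance (first_pair d) = 1 / of_nat d"
proof (cases "odd d")
  case True
  then obtain m where "d = 2 * m + 1"
    by (elim oddE)
  then show ?thesis
    by (simp add: first_pair_def imbalance_def)
next
  case False
  then show ?thesis
    using assms by (simp add: first_pair_def imbalance_def field_simps)
qed

lemma reduced_denom_first_pair:
  assumes "d \<ge> 2"
  shows "reduced_denom (first_pair d) = d"
proof -
  have "imbalance (first_pair d) = Fract 1 (int d)"
    using assms by (simp add: imbalance_first_pair Fract_of_int_quotient)
  then show ?thesis
    using assms by (simp add: reduced_denom_def quotient_of_Fract normalize_def Let_def)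
qed

lemma first_occurrence_first_pair:
  assumes "d \<ge> 2"
  shows "first_occurrence d (first_pair d)"
  unfolding first_occurrence_def
proof (intro conjI ballI impI)
  fix y assume y: "y \<in> pairs" "reduced_denom y = d \<and> y \<noteq> first_pair d"
  obtain p q where yeq: "y = (p, q)"
    by (cases y)
  have pq: "2 \<le> p" "1 \<le> q" "q < p"
    using y by (auto simp: pairs_def yeq)
  obtain k where k: "p + q = k * d" "k \<ge> 1" "even d \<Longrightarrow> k \<ge> 2"
    using reduced_denom_dvd_sum y yeq by metis
  show "precedes (first_pair d) y"
  proof (cases "odd d")
    case True
    then obtain m where m: "d = 2 * m + 1"
      by (elim oddE)
    have "p + q \<ge> 2 * m + 1"
      using mult_le_mono1[OF k(2), of d] k(1) m by simp
    then show ?thesis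
      using y(2) pq True by (auto simp: precedes_def first_pair_def yeq m)
  next
    case False
    then have "2 * d \<le> p + q"
      using mult_le_mono1[of 2 k d] k(1,3) by simp
    \<comment> \<open>In the row \<open>p = d + 1\<close> this leaves \<open>q = d - 1\<close> and \<open>q = d\<close>, and even the latter comes
      after the claimed pair.\<close>
    then show ?thesis
      using y(2) pq False by (auto simp: precedes_def first_pair_def yeq)
  qed
qed (use assms in \<open>simp_all add: first_pair_in_pairs reduced_denom_first_pair\<close>)

lemma iteration_index_first_pair_le:
  assumes "x \<in> pairs"
  shows "iteration_index (first_pair (reduced_denom x)) \<le> iteration_index x"
  using assms first_occurrence_first_pair[OF reduced_denom_ge_2[OF assms]]
    iteration_index_strict_mono[of "first_pair (reduced_denom x)" x]
  by (cases "x = first_pair (reduced_denom x)") (auto simp: first_occurrence_def)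

lemma first_index_eq:
  assumes "d \<ge> 2"
  shows "first_index d = iteration_index (first_pair d)"
  unfolding first_index_def
proof (rule Least_equality)
  show "\<exists>x\<in>pairs. reduced_denom x = d \<and> iteration_index x = iteration_index (first_pair d)"
    using assms first_pair_in_pairs reduced_denom_first_pair by blast
qed (use iteration_index_first_pair_le in blast)

lemma two_times_first_index_odd:
  "m \<ge> 1 \<Longrightarrow> 2 * first_index (2 * m + 1) = (m - 1) * m + 2 * (m - 1)"
  using two_times_iteration_index[of "m + 1" m]
  by (simp add: first_index_eq first_pair_def)

lemma two_times_first_index_even:
  "even d \<Longrightarrow> d \<ge> 2 \<Longrightarrow> 2 * first_index d = (d - 1) * d + 2 * (d - 2)"
  using two_times_iteration_index[of "d + 1" "d - 1"]
  by (simp add: first_index_eq first_pair_def numeral_2_eq_2)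

lemma of_nat_first_index:
  assumes "d \<ge> 2"
  shows "(of_nat (first_index d) :: rat) =
    (if odd d then ((of_nat d)^2 - 9) / 8 else of_nat d * (of_nat d + 1) / 2 - 2)"
proof (cases "odd d")
  case True
  then obtain m where "d = 2 * m + 1"
    by (elim oddE)
  then obtain j where j: "d = 2 * Suc j + 1"
    using assms by (cases m) auto
  have "2 * first_index d = j * Suc j + 2 * j"
    using two_times_first_index_odd[of "Suc j"] by (simp add: j)
  then have "2 * (of_nat (first_index d) :: rat) = of_nat (j * Suc j + 2 * j)"
    by (metis of_nat_mult of_nat_numeral)
  then show ?thesis
    using True by (simp add: j power2_eq_square field_simps)
next
  case False
  obtain j where j: "d = j + 2"
    using assms by (metis le_add_diff_inverse2)
  have "2 * first_index d = (j + 1) * (j + 2) + 2 * j"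
    using two_times_first_index_even[of d] False by (simp add: j)
  then have "2 * (of_nat (first_index d) :: rat) = of_nat ((j + 1) * (j + 2) + 2 * j)"
    by (metis of_nat_mult of_nat_numeral)
  then show ?thesis
    using False by (simp add: j field_simps)
qed

section \<open>The order of appearance\<close>

text \<open>A step records a denominator \<open>d\<close> exactly if it is the earliest step that produces \<open>d\<close>,
  and every \<open>d \<ge> 2\<close> is produced by \<open>first_pair d\<close>.\<close>

lemma recording_steps_eq: "recording_steps = first_index ` {2..}"
proof (intro equalityI subsetI)
  fix n assume n: "n \<in> recording_steps"
  define d where "d = reduced_denom (pair_at n)"
  have d: "d \<ge> 2"
    by (simp add: d_def reduced_denom_ge_2 pair_at_in_pairs)
  have "first_index d \<le> n"
    using iteration_index_first_pair_le[OF pair_at_in_pairs[of n]] d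
    by (simp add: first_index_eq iteration_index_pair_at flip: d_def)
  moreover have "reduced_denom (pair_at (first_index d)) = d"
    using d by (simp add: first_index_eq pair_at_iteration_index first_pair_in_pairs
        reduced_denom_first_pair)
  ultimately have "first_index d = n"
    using n by (metis (mono_tags, lifting) d_def le_neq_implies_less mem_Collect_eq
        recording_steps_def)
  then show "n \<in> first_index ` {2..}"
    using d by auto
next
  fix n assume "n \<in> first_index ` {2..}"
  then obtain d where d: "d \<ge> 2" "n = first_index d"
    by auto
  have "reduced_denom (pair_at n) = d"
    using d by (simp add: first_index_eq pair_at_iteration_index first_pair_in_pairs
        reduced_denom_first_pair)
  moreover have "reduced_denom (pair_at m) \<noteq> d" if "m < n" for m
    using iteration_index_first_pair_le[OF pair_at_in_pairs[of m]] d that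
    by (auto simp: first_index_eq iteration_index_pair_at)
  ultimately show "n \<in> recording_steps"
    by (simp add: recording_steps_def)
qed

text \<open>The closed form of the order of appearance: block \<open>j\<close> is \<open>4 j + 3, 2 j + 2, 4 j + 5\<close>.
  Both index formulas are quadratic in \<open>d\<close>, with leading coefficient \<open>1 / 8\<close> for odd and
  \<open>1 / 2\<close> for even \<open>d\<close>; thus an even \<open>d\<close> appears at about the same time as the odd numbers
  near \<open>2 d\<close>, which is why two odd denominators come with each even one.\<close>

definition sieve_order :: "nat \<Rightarrow> nat" where
  "sieve_order k = (let j = k div 3 in
     if k mod 3 = 0 then 4 * j + 3 else if k mod 3 = 1 then 2 * j + 2 else 4 * j + 5)"

lemma sieve_order_ge_2: "sieve_order k \<ge> 2"
  by (simp add: sieve_order_def Let_def)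

lemma sieve_order_simps:
  "sieve_order (3 * j) = 4 * j + 3"
  "sieve_order (3 * j + 1) = 2 * j + 2"
  "sieve_order (3 * j + 2) = 4 * j + 5"
proof -
  have "(3 * j + 2) div 3 = j" "(3 * j + 2) mod 3 = 2"
    by presburger+
  then show "sieve_order (3 * j + 2) = 4 * j + 5"
    by (simp add: sieve_order_def)
qed (simp_all add: sieve_order_def)

lemma sieve_order_surj:
  assumes "d \<ge> 2"
  shows "\<exists>k. sieve_order k = d"
proof -
  consider j where "d = 2 * j + 2" | j where "d = 4 * j + 3" | j where "d = 4 * j + 5"
    using assms by atomize_elim presburger
  then show ?thesis
    by cases (use sieve_order_simps in blast)+
qed

lemma first_index_sieve_order:
  "first_index (4 * j + 3) = 2 * j * j + 3 * j"
  "first_index (2 * j + 2) = 2 * j * j + 5 * j + 1"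
  "first_index (4 * j + 5) = 2 * j * j + 5 * j + 2"
proof -
  have eq: "4 * j + 3 = 2 * (2 * j + 1) + 1"
    by simp
  have "2 * first_index (4 * j + 3) = 2 * j * (2 * j + 1) + 2 * (2 * j)"
    using two_times_first_index_odd[of "2 * j + 1", folded eq] by simp
  then show "first_index (4 * j + 3) = 2 * j * j + 3 * j"
    by (simp add: distrib_left)
  have "2 * first_index (2 * j + 2) = (2 * j + 1) * (2 * j + 2) + 2 * (2 * j)"
    using two_times_first_index_even[of "2 * j + 2"] by simp
  then show "first_index (2 * j + 2) = 2 * j * j + 5 * j + 1"
    by (simp add: distrib_left)
  have eq: "4 * j + 5 = 2 * (2 * j + 2) + 1"
    by simp
  have "2 * first_index (4 * j + 5) = (2 * j + 1) * (2 * j + 2) + 2 * (2 * j + 1)"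
    using two_times_first_index_odd[of "2 * j + 2", folded eq] by simp
  then show "first_index (4 * j + 5) = 2 * j * j + 5 * j + 2"
    by (simp add: distrib_left)
qed

lemma strict_mono_first_index_sieve_order: "strict_mono (\<lambda>k. first_index (sieve_order k))"
  unfolding strict_mono_Suc_iff
proof
  fix k :: nat
  consider j where "k = 3 * j" | j where "k = 3 * j + 1" | j where "k = 3 * j + 2"
    by atomize_elim presburger
  then show "first_index (sieve_order k) < first_index (sieve_order (Suc k))"
  proof cases
    case 1
    then show ?thesis
      using sieve_order_simps[of j] first_index_sieve_order[of j] by simp
  next
    case 2
    then show ?thesis
      using sieve_order_simps[of j] first_index_sieve_order[of j] by simp
  next
    case 3
    then have "Suc k = 3 * (j + 1)"
      by simp
    then have "sieve_order k = 4 * j + 5" "sieve_order (Suc k) = 4 * (j + 1) + 3"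
      using 3 sieve_order_simps by metis+
    then have "first_index (sieve_order k) = 2 * j * j + 5 * j + 2"
      "first_index (sieve_order (Suc k)) = 2 * (j + 1) * (j + 1) + 3 * (j + 1)"
      by (simp_all only: first_index_sieve_order)
    then show ?thesis
      by simp
  qed
qed

lemma enumerate_range_strict_mono:
  fixes f :: "nat \<Rightarrow> nat"
  assumes "strict_mono f"
  shows "enumerate (range f) n = f n"
proof -
  have "infinite (range f)"
    using assms by (simp add: range_inj_infinite strict_mono_imp_inj_on)
  show ?thesis
  proof (induction n rule: less_induct)
    case (less n)
    show ?case
    proof (cases n)
      case 0
      have "(LEAST s. s \<in> range f) = f 0"
        using assms by (intro Least_equality) (auto simp: strict_mono_less_eq)
      then show ?thesis
        by (simp add: 0 enumerate_0)
    next
      case (Suc m)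
      have "(LEAST s. s \<in> range f \<and> f m < s) = f (Suc m)"
        using assms by (intro Least_equality) (auto simp: strict_mono_less_eq strict_mono_less)
      then show ?thesis
        using less[of m] \<open>infinite (range f)\<close> by (simp add: Suc enumerate_Suc'')
    qed
  qed
qed

lemma recorded_eq_sieve_order: "recorded k = sieve_order k"
proof -
  have "range sieve_order = {2..}"
    using sieve_order_ge_2 sieve_order_surj by (auto, metis rangeI)
  then have "recording_steps = range (\<lambda>k. first_index (sieve_order k))"
    by (metis image_image recording_steps_eq)
  then have "enumerate recording_steps k = first_index (sieve_order k)"
    using enumerate_range_strict_mono[OF strict_mono_first_index_sieve_order] by simp
  then show ?thesis
    by (simp add: recorded_def first_index_eq sieve_order_ge_2 pair_at_iteration_index
        first_pair_in_pairs reduced_denom_first_pair)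
qed

theorem theorem5p1:
  "(\<forall>d\<ge>2. \<exists>x. first_occurrence d x
        \<and> imbalance x = 1 / of_nat d
        \<and> iteration_index x = first_index d
        \<and> (of_nat (first_index d) :: rat) =
            (if odd d then ((of_nat d)^2 - 9) / 8
             else of_nat d * (of_nat d + 1) / 2 - 2))
   \<and> map recorded [0..<17] = [3, 2, 5, 7, 4, 9, 11, 6, 13, 15, 8, 17, 19, 10, 21, 23, 12]
   \<and> strict_mono (\<lambda>k. first_index (recorded k))
   \<and> (\<forall>d\<ge>2. \<exists>!k. recorded k = d)"
proof (intro conjI allI impI)
  fix d :: nat assume "d \<ge> 2"
  then show "\<exists>x. first_occurrence d x
        \<and> imbalance x = 1 / of_nat d
        \<and> iteration_index x = first_index d
        \<and> (of_nat (first_index d) :: rat) =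
            (if odd d then ((of_nat d)^2 - 9) / 8
             else of_nat d * (of_nat d + 1) / 2 - 2)"
    using first_occurrence_first_pair imbalance_first_pair first_index_eq of_nat_first_index
    by (intro exI[of _ "first_pair d"]) auto
next
  show "map recorded [0..<17] = [3, 2, 5, 7, 4, 9, 11, 6, 13, 15, 8, 17, 19, 10, 21, 23, 12]"
    unfolding ext[of recorded sieve_order, OF recorded_eq_sieve_order] by (simp add: upt_conv_Cons sieve_order_def)
next
  show "strict_mono (\<lambda>k. first_index (recorded k))"
    by (simp add: recorded_eq_sieve_order strict_mono_first_index_sieve_order)
next
  fix d :: nat assume "d \<ge> 2"
  then obtain k where "recorded k = d"
    using sieve_order_surj recorded_eq_sieve_order by auto
  moreover have "inj recorded"
    using strict_mono_imp_inj_on[OF strict_mono_first_index_sieve_order, of UNIV]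
    by (auto simp: inj_on_def recorded_eq_sieve_order)
  ultimately show "\<exists>!k. recorded k = d"
    by (auto dest: injD)
qed

end
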